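(* Suppose that: (A1) each $f_i:\mathbb{R}^n\to\mathbb{R}$ ($i=1,\dots,m$) is differentiable, bounded from below, and $\|\nabla f_i(x)-\nabla f_i(y)\|\le L\|x-y\|$ for all $x,y\in\mathbb{R}^n$; (A2) there is $M>0$ such that $\|\nabla f_i(x)\|\le M$ for all $x\in\mathbb{R}^n$ and all $i$; (A3) for every $a\in\mathbb{R}^m$ the level set $\{x\in\mathbb{R}^n: f_i(x)\le a_i,\ i=1,\dots,m\}$ is bounded. Then for every $x_0\in\mathbb{R}^n$ there exists an absolutely continuous function $x:[t_0,+\infty)\to\mathbb{R}^n$ which solves the Cauchy problem $$\dot x(t)=-\mathbf{proj}_{C_\alpha(x(t),t)}(0),\qquad x(t_0)=x_0 .$$
   Context: Here $t_0\ge 0$, and $\alpha_i:\mathbb{R}^n\times[t_0,+\infty)\to\mathbb{R}$ ($i=1,\dots,m$) are functions with $|\alpha_i(u,t)-\alpha_i(v,s)|\le L_{\alpha_i}\|(u,t)-(v,s)\|$ and $\alpha_{\min}\le\alpha_i(u,t)\le\alpha_{\max}$ for all $(u,t),(v,s)$, where $0<\alpha_{\min}\le\alpha_{\max}<\infty$ are constants. The set $C_\alpha(u,t)$ is the convex hull of $\left\{\frac{\nabla f_i(u)}{\alpha_i(u,t)} : i=1,\dots,m\right\}$. For a closed convex set $C$, $\mathbf{proj}_C(x)$ is the Euclidean projection of $x$ onto $C$. A solution satisfies the differential equation for almost every $t$; absolute continuity on an unbounded interval means absolute continuity on every compact subinterval. *)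

theory Defs
  imports "HOL-Analysis.Analysis"
begin

definition gradient :: "('a::euclidean_space \<Rightarrow> real) \<Rightarrow> 'a \<Rightarrow> 'a" where
  "gradient f x = (THE D. GDERIV f x :> D)"

lemma GDERIV_gradient:
  fixes f :: "'a::euclidean_space \<Rightarrow> real"
  assumes "f differentiable (at x)"
  shows "GDERIV f x :> gradient f x"
proof -
  obtain f' where f': "(f has_derivative f') (at x)"
    using assms by (auto simp: differentiable_def)
  then have "linear f'"
    by (rule has_derivative_linear)
  then have "f' = (\<lambda>h. h \<bullet> adjoint f' 1)"
    by (auto simp: adjoint_works)
  then have ex: "GDERIV f x :> adjoint f' 1"
    using f' by (simp add: gderiv_def)
  have "D = E" if "GDERIV f x :> D" "GDERIV f x :> E" for D E
  proof -
    have "(\<lambda>h. h \<bullet> D) = (\<lambda>h. h \<bullet> E)"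
      using that unfolding gderiv_def by (rule has_derivative_unique)
    then show ?thesis
      by (metis vector_eq_ldot)
  qed
  with ex show ?thesis
    unfolding gradient_def by (metis theI)
qed

text \<open>
  The standard \<open>\<epsilon>\<close>-\<open>\<delta>\<close> definition over finite families of non-overlapping intervals in \<open>S\<close>. It is
  unrelated to the library's \<^const>\<open>absolutely_continuous\<close>, which is a relation between measures.
\<close>

definition absolutely_continuous_on :: "real set \<Rightarrow> (real \<Rightarrow> 'a::real_normed_vector) \<Rightarrow> bool" where
  "absolutely_continuous_on S x \<longleftrightarrow>
    (\<forall>\<epsilon>>0. \<exists>\<delta>>0. \<forall>D. finite D \<and>
       (\<forall>(a, b)\<in>D. a < b \<and> {a..b} \<subseteq> S) \<and>
       pairwise (\<lambda>(a, b) (c, d). disjnt {a<..<b} {c<..<d}) D \<and>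
       (\<Sum>(a, b)\<in>D. b - a) < \<delta>
       \<longrightarrow> (\<Sum>(a, b)\<in>D. norm (x b - x a)) < \<epsilon>)"

definition locally_absolutely_continuous_on ::
    "real set \<Rightarrow> (real \<Rightarrow> 'a::real_normed_vector) \<Rightarrow> bool" where
  "locally_absolutely_continuous_on S x \<longleftrightarrow>
    (\<forall>a b. {a..b} \<subseteq> S \<longrightarrow> absolutely_continuous_on {a..b} x)"

definition C_alpha ::
    "('m \<Rightarrow> 'a::euclidean_space \<Rightarrow> real) \<Rightarrow> ('m \<Rightarrow> 'a \<Rightarrow> real \<Rightarrow> real) \<Rightarrow> 'a \<Rightarrow> real \<Rightarrow> 'a set" where
  "C_alpha f \<alpha> u t = convex hull (range (\<lambda>i. gradient (f i) u /\<^sub>R \<alpha> i u t))"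

end

theory Submission
  imports Defs "HOL-Complex_Analysis.Great_Picard"
begin

text \<open>
  The right-hand side \<open>F(u, t) = - proj\<^bsub>C\<^sub>\<alpha>(u,t)\<^esub>(0)\<close> is continuous and bounded on all of
  \<open>\<real>\<^sup>n \<times> [t\<^sub>0, \<infinity>)\<close>, so Peano's theorem yields a global solution. That solution is Lipschitz, hence
  locally absolutely continuous, and it satisfies the equation at every \<open>t \<ge> t\<^sub>0\<close>.

  Boundedness and continuity (\<open>norm_closest_point_convex_hull_le\<close>,
  \<open>continuous_on_closest_point_convex_hull\<close>) come from the vertices \<open>\<nabla>f\<^sub>i(u) / \<alpha>\<^sub>i(u, t)\<close>, which are
  continuous and bounded by \<open>M / \<alpha>\<^sub>m\<^sub>i\<^sub>n\<close>. If all vertices move by at most \<open>\<epsilon>\<close>, the hulls stay within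
  distance \<open>\<epsilon>\<close> of each other, and the variational inequalities for the two projections \<open>p\<close>, \<open>q\<close> of
  the origin combine to \<open>\<parallel>p - q\<parallel>\<^sup>2 \<le> \<epsilon> (\<parallel>p\<parallel> + \<parallel>q\<parallel>)\<close>.

  Peano's theorem (\<open>peano_existence_bounded\<close>) is proved with Euler's explicit scheme, where the
  approximation of mesh \<open>h\<close> is the step function taking the value of the last node. Its increments
  are bounded by \<open>M (\<bar>t - s\<bar> + h)\<close>, so a diagonal subsequence that converges at the rational times
  converges at all times. The limit is differentiated directly: near \<open>(x(t), t)\<close> all the slopes used
  by a fine Euler scheme are within \<open>\<epsilon>\<close> of \<open>F(x(t), t)\<close>, hence so are its difference quotients, up to
  an error that vanishes with \<open>h\<close>. This needs only pointwise convergence and no integration, and it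
  treats the half-line in one piece, without gluing solutions on bounded intervals.
\<close>

section \<open>Euler approximations\<close>

primrec euler_node ::
    "('a::real_normed_vector \<Rightarrow> real \<Rightarrow> 'a) \<Rightarrow> real \<Rightarrow> 'a \<Rightarrow> real \<Rightarrow> nat \<Rightarrow> 'a" where
  "euler_node F a x0 h 0 = x0"
| "euler_node F a x0 h (Suc j) =
     euler_node F a x0 h j + h *\<^sub>R F (euler_node F a x0 h j) (a + real j * h)"

text \<open>
  Piecewise constant rather than piecewise linear interpolation: the increments are then plain finite
  sums over nodes, and the jumps have size \<open>O(h)\<close> when \<open>F\<close> is bounded.
\<close>

definition euler_step ::
    "('a::real_normed_vector \<Rightarrow> real \<Rightarrow> 'a) \<Rightarrow> real \<Rightarrow> 'a \<Rightarrow> real \<Rightarrow> real \<Rightarrow> 'a" where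
  "euler_step F a x0 h t = euler_node F a x0 h (nat \<lfloor>(t - a) / h\<rfloor>)"

lemma euler_step_start [simp]: "euler_step F a x0 h a = x0"
  by (simp add: euler_step_def)

lemma euler_step_at_node:
  assumes "h > 0"
  shows "euler_step F a x0 h (a + real j * h) = euler_node F a x0 h j"
  using assms by (simp add: euler_step_def)

lemma euler_node_diff:
  assumes "m \<le> n"
  shows "euler_node F a x0 h n - euler_node F a x0 h m
         = (\<Sum>j=m..<n. h *\<^sub>R F (euler_node F a x0 h j) (a + real j * h))"
proof -
  have "(\<Sum>j=m..<n. h *\<^sub>R F (euler_node F a x0 h j) (a + real j * h))
        = (\<Sum>j=m..<n. euler_node F a x0 h (Suc j) - euler_node F a x0 h j)"
    by simp
  then show ?thesis
    using sum_Suc_diff'[OF assms, of "euler_node F a x0 h"] by simp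
qed

text \<open>
  The increment over \<open>[s, t]\<close> is the sum of \<open>h F\<close> over the nodes passed. Since the scheme jumps at
  nodes, the first of these nodes may lie up to one mesh width before \<open>s\<close>, and the total length of
  the steps taken differs from \<open>t - s\<close> by at most \<open>h\<close>; the two summands of the bound reflect this.
  With \<open>v = 0\<close> the estimate controls the modulus of continuity, and with \<open>v\<close> a value of \<open>F\<close> the
  difference quotients.
\<close>

lemma euler_step_increment:
  assumes h: "h > 0" and "a \<le> s" "s \<le> t" and "\<epsilon> \<ge> 0"
    and near: "\<And>r. a \<le> r \<Longrightarrow> s - h \<le> r \<Longrightarrow> r \<le> t \<Longrightarrow> norm (F (euler_step F a x0 h r) r - v) \<le> \<epsilon>"
  shows "norm (euler_step F a x0 h t - euler_step F a x0 h s - (t - s) *\<^sub>R v)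
         \<le> \<epsilon> * (t - s + h) + h * norm v"
proof -
  define m where "m = nat \<lfloor>(s - a) / h\<rfloor>"
  define n where "n = nat \<lfloor>(t - a) / h\<rfloor>"
  let ?y = "euler_node F a x0 h"
  have m: "real m * h \<le> s - a" "s - a \<le> (real m + 1) * h"
    unfolding m_def using h \<open>a \<le> s\<close>
    by (simp_all flip: pos_le_divide_eq pos_divide_le_eq)
  have n: "real n * h \<le> t - a" "t - a \<le> (real n + 1) * h"
    unfolding n_def using h \<open>a \<le> s\<close> \<open>s \<le> t\<close>
    by (simp_all flip: pos_le_divide_eq pos_divide_le_eq)
  have "m \<le> n"
    unfolding m_def n_def using h \<open>s \<le> t\<close>
    by (intro nat_mono floor_mono divide_right_mono) auto
  define c where "c = (real n - real m) * h"
  have c: "0 \<le> c" "c \<le> t - s + h" "\<bar>c - (t - s)\<bar> \<le> h"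
    using m n h \<open>m \<le> n\<close> by (auto simp: c_def algebra_simps)
  have slope: "norm (F (?y j) (a + real j * h) - v) \<le> \<epsilon>" if "j \<in> {m..<n}" for j
  proof -
    have "0 \<le> real j * h" "real m * h \<le> real j * h" "real j * h \<le> real n * h"
      using that h by auto
    then have "norm (F (euler_step F a x0 h (a + real j * h)) (a + real j * h) - v) \<le> \<epsilon>"
      using m n h \<open>a \<le> s\<close> unfolding distrib_right by (intro near; linarith)
    then show ?thesis
      using h by (simp add: euler_step_at_node)
  qed
  have "c *\<^sub>R v = (\<Sum>j=m..<n. h *\<^sub>R v)"
    using \<open>m \<le> n\<close> by (simp add: c_def of_nat_diff sum_constant_scaleR)
  then have "?y n - ?y m - c *\<^sub>R v = (\<Sum>j=m..<n. h *\<^sub>R (F (?y j) (a + real j * h) - v))"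
    using \<open>m \<le> n\<close> by (simp only: euler_node_diff scaleR_diff_right sum_subtractf)
  also have "norm \<dots> \<le> (\<Sum>j=m..<n. h * \<epsilon>)"
    using slope h by (intro sum_norm_le) auto
  also have "\<dots> = c * \<epsilon>"
    using \<open>m \<le> n\<close> by (simp add: c_def of_nat_diff)
  also have "\<dots> \<le> \<epsilon> * (t - s + h)"
    using c \<open>\<epsilon> \<ge> 0\<close> by (simp add: mult.commute mult_left_mono)
  finally have *: "norm (?y n - ?y m - c *\<^sub>R v) \<le> \<epsilon> * (t - s + h)" .
  have "?y n - ?y m - (t - s) *\<^sub>R v = (?y n - ?y m - c *\<^sub>R v) + (c - (t - s)) *\<^sub>R v"
    by (simp add: algebra_simps)
  also have "norm \<dots> \<le> \<epsilon> * (t - s + h) + \<bar>c - (t - s)\<bar> * norm v"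
    using * by (intro norm_triangle_mono) auto
  also have "\<dots> \<le> \<epsilon> * (t - s + h) + h * norm v"
    using c by (intro add_left_mono mult_right_mono) auto
  finally show ?thesis
    by (simp add: euler_step_def m_def n_def)
qed

lemma euler_step_lipschitz_up_to_mesh:
  assumes h: "h > 0" and "a \<le> s" "a \<le> t"
    and bound: "\<And>u r. a \<le> r \<Longrightarrow> norm (F u r) \<le> M"
  shows "norm (euler_step F a x0 h t - euler_step F a x0 h s) \<le> M * (\<bar>t - s\<bar> + h)"
proof -
  have "M \<ge> 0"
    using bound[of a x0] norm_ge_zero order_trans by blast
  have *: "norm (euler_step F a x0 h q - euler_step F a x0 h p) \<le> M * (q - p + h)"
    if "a \<le> p" "p \<le> q" for p q
    using euler_step_increment[OF h that \<open>M \<ge> 0\<close>, of F x0 0] bound by simp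
  show ?thesis
    using *[of s t] *[of t s] assms by (cases "s \<le> t") (auto simp: norm_minus_commute)
qed

section \<open>Peano's existence theorem\<close>

text \<open>
  A diagonal argument gives convergence at rational times. It carries over to all other times
  because the Euler schemes are equicontinuous up to their mesh, which tends to zero.
\<close>

lemma euler_steps_subsequence_converges:
  fixes F :: "'a::{real_normed_vector,heine_borel} \<Rightarrow> real \<Rightarrow> 'a"
  assumes bound: "\<And>u t. a \<le> t \<Longrightarrow> norm (F u t) \<le> M"
  shows "\<exists>h x. (\<forall>k::nat. h k > 0) \<and> h \<longlonglongrightarrow> 0 \<and>
           (\<forall>t\<ge>a. (\<lambda>k. euler_step F a x0 (h k) t) \<longlonglongrightarrow> x t)"
proof -
  define E where "E k = euler_step F a x0 (inverse (real (Suc k)))" for k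
  have M: "M \<ge> 0"
    using bound[of a x0] norm_ge_zero order_trans by blast
  have E_diff: "norm (E k t - E k s) \<le> M * (\<bar>t - s\<bar> + inverse (real (Suc k)))"
    if "a \<le> s" "a \<le> t" for k s t
    unfolding E_def using that bound by (intro euler_step_lipschitz_up_to_mesh) auto
  \<comment> \<open>On the half-line the schemes may grow linearly; the weight makes them bounded uniformly in
    time, as in the hypothesis of \<open>function_convergent_subsequence\<close>.\<close>
  define w where "w q = 1 + \<bar>q - a\<bar>" for q :: real
  have w: "w q > 0" for q
    by (simp add: w_def add_pos_nonneg)
  have E_bound: "norm (E k q /\<^sub>R w q) \<le> M + norm x0" if "q \<in> \<rat> \<inter> {a..}" for k q
  proof -
    have "norm (E k q) \<le> norm (E k q - E k a) + norm x0"
      using norm_triangle_ineq[of "E k q - E k a" x0] by (simp add: E_def)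
    also have "norm (E k q - E k a) \<le> M * (\<bar>q - a\<bar> + inverse (real (Suc k)))"
      using that by (intro E_diff) auto
    also have "\<dots> \<le> M * w q"
      using M by (intro mult_left_mono) (auto simp: w_def inverse_le_1_iff)
    also have "norm x0 \<le> norm x0 * w q"
      by (simp add: w_def mult_le_cancel_left1)
    finally have "norm (E k q) \<le> (M + norm x0) * w q"
      by (simp add: algebra_simps)
    then show ?thesis
      using w[of q] by (simp add: field_simps)
  qed
  have "countable (\<rat> \<inter> {a..} :: real set)"
    by (simp add: countable_rat)
  then have "\<exists>\<sigma>::nat \<Rightarrow> nat. strict_mono \<sigma> \<and>
      (\<forall>q \<in> \<rat> \<inter> {a..}. \<exists>l. (\<lambda>k. E (\<sigma> k) q /\<^sub>R w q) \<longlonglongrightarrow> l)"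
    by (rule function_convergent_subsequence[where f = "\<lambda>k q. E k q /\<^sub>R w q", OF _ E_bound])
      (assumption, rule exI, rule conjI, assumption, blast)
  then obtain \<sigma> :: "nat \<Rightarrow> nat" where \<sigma>: "strict_mono \<sigma>"
    and conv: "\<And>q. q \<in> \<rat> \<inter> {a..} \<Longrightarrow> \<exists>l. (\<lambda>k. E (\<sigma> k) q /\<^sub>R w q) \<longlonglongrightarrow> l"
    by blast
  define h where "h k = inverse (real (Suc (\<sigma> k)))" for k
  have h: "h \<longlonglongrightarrow> 0"
    using LIMSEQ_subseq_LIMSEQ[OF LIMSEQ_inverse_real_of_nat \<sigma>] unfolding o_def h_def .
  have Cauchy_rat: "Cauchy (\<lambda>k. E (\<sigma> k) q)" if q: "q \<in> \<rat> \<inter> {a..}" for q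
  proof -
    obtain l where "(\<lambda>k. E (\<sigma> k) q /\<^sub>R w q) \<longlonglongrightarrow> l"
      using conv[OF q] by (elim exE)
    then have "(\<lambda>k. w q *\<^sub>R (E (\<sigma> k) q /\<^sub>R w q)) \<longlonglongrightarrow> w q *\<^sub>R l"
      by (rule tendsto_scaleR[OF tendsto_const])
    then show ?thesis
      using w[of q] by (auto intro!: LIMSEQ_imp_Cauchy)
  qed
  have "Cauchy (\<lambda>k. E (\<sigma> k) t)" if "a \<le> t" for t
    unfolding Cauchy_altdef
  proof (intro allI impI)
    fix e :: real assume "e > 0"
    \<comment> \<open>Passing from \<open>t\<close> to a rational point and back costs at most \<open>M (d + h)\<close> each way. Dividing
      by \<open>M + 1\<close> instead of \<open>M\<close> covers \<open>M = 0\<close>.\<close>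
    define d where "d = (e / 6) / (M + 1)"
    have "d > 0"
      using M \<open>e > 0\<close> by (simp add: d_def)
    have "M + 1 \<noteq> 0"
      using M by simp
    then have d_eq: "d * (M + 1) = e / 6"
      by (rule iffD1[OF nonzero_eq_divide_eq d_def])
    obtain q where "q \<in> \<rat>" "t < q" "q < t + d"
      using Rats_dense_in_real[of t "t + d"] \<open>d > 0\<close> by auto
    then have q: "q \<in> \<rat> \<inter> {a..}" "\<bar>t - q\<bar> \<le> d"
      using that by auto
    obtain N1 where N1: "\<And>m n. m \<ge> N1 \<Longrightarrow> n \<ge> N1 \<Longrightarrow> dist (E (\<sigma> m) q) (E (\<sigma> n) q) < e / 3"
      using Cauchy_rat[OF q(1)] \<open>e > 0\<close> unfolding Cauchy_def by (metis zero_less_divide_iff zero_less_numeral)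
    obtain N2 where N2: "\<And>n. n \<ge> N2 \<Longrightarrow> h n < d"
      using order_tendstoD(2)[OF h \<open>d > 0\<close>] by (auto simp: eventually_sequentially)
    have near: "dist (E (\<sigma> n) t) (E (\<sigma> n) q) < e / 3" if "n \<ge> N2" for n
    proof -
      have "dist (E (\<sigma> n) t) (E (\<sigma> n) q) \<le> M * (\<bar>t - q\<bar> + h n)"
        using E_diff[of q t "\<sigma> n"] \<open>a \<le> t\<close> q by (simp add: dist_norm h_def)
      also have "\<dots> \<le> M * (d + d)"
        using M N2[OF that] q by (intro mult_left_mono) auto
      also have "\<dots> < (M + 1) * (d + d)"
        using \<open>d > 0\<close> by (simp add: algebra_simps)
      also have "\<dots> = e / 3"
        using d_eq by (simp add: algebra_simps)
      finally show ?thesis .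
    qed
    have "dist (E (\<sigma> m) t) (E (\<sigma> n) t) < e" if "m \<ge> max N1 N2" "n \<ge> max N1 N2" for m n
      using near[of m] near[of n] N1[of m n] that
        dist_triangle[of "E (\<sigma> m) t" "E (\<sigma> n) t" "E (\<sigma> m) q"]
        dist_triangle[of "E (\<sigma> m) q" "E (\<sigma> n) t" "E (\<sigma> n) q"]
      by (simp add: dist_commute)
    then show "\<exists>N. \<forall>m\<ge>N. \<forall>n>m. dist (E (\<sigma> m) t) (E (\<sigma> n) t) < e"
      by (intro exI[of _ "max N1 N2"]) auto
  qed
  then have "\<forall>t\<ge>a. (\<lambda>k. E (\<sigma> k) t) \<longlonglongrightarrow> lim (\<lambda>k. E (\<sigma> k) t)"
    by (simp add: Cauchy_convergent_iff convergent_LIMSEQ_iff)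
  then have "\<forall>t\<ge>a. (\<lambda>k. euler_step F a x0 (h k) t) \<longlonglongrightarrow> lim (\<lambda>k. E (\<sigma> k) t)"
    by (simp add: E_def h_def)
  moreover have "\<forall>k. h k > 0"
    by (simp add: h_def)
  ultimately show ?thesis
    using h by (intro exI[of _ h] exI[of _ "\<lambda>t. lim (\<lambda>k. E (\<sigma> k) t)"] conjI)
qed

text \<open>
  Near \<open>(x t, t)\<close> continuity keeps all slopes of a fine Euler scheme close to \<open>F (x t) t\<close>, so
  \<open>euler_step_increment\<close> bounds its deviation from the tangent line. In the limit the mesh terms
  disappear and exactly the definition of the derivative remains.
\<close>

lemma euler_limit_has_vector_derivative:
  fixes F :: "'a::real_normed_vector \<Rightarrow> real \<Rightarrow> 'a"
  assumes cont: "continuous_on (UNIV \<times> {a..}) (\<lambda>(u, t). F u t)"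
    and bound: "\<And>u t. a \<le> t \<Longrightarrow> norm (F u t) \<le> M"
    and h: "\<And>k::nat. h k > 0" "h \<longlonglongrightarrow> 0"
    and lim: "\<And>t. a \<le> t \<Longrightarrow> (\<lambda>k. euler_step F a x0 (h k) t) \<longlonglongrightarrow> x t"
    and "a \<le> t"
  shows "(x has_vector_derivative F (x t) t) (at t within {a..})"
proof -
  let ?E = "\<lambda>k. euler_step F a x0 (h k)" and ?v = "F (x t) t"
  have M: "M \<ge> 0"
    using bound[of a x0] norm_ge_zero order_trans by blast
  have "\<exists>d>0. \<forall>s\<in>{a..}. norm (s - t) < d \<longrightarrow>
           norm (x s - x t - (s - t) *\<^sub>R ?v) \<le> \<epsilon> * norm (s - t)" if "\<epsilon> > 0" for \<epsilon>
  proof -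
    obtain \<delta> where "\<delta> > 0"
      and \<delta>: "\<And>u r. a \<le> r \<Longrightarrow> dist (u, r) (x t, t) < \<delta> \<Longrightarrow> dist (F u r) ?v < \<epsilon>"
      using cont \<open>a \<le> t\<close> \<open>\<epsilon> > 0\<close> unfolding continuous_on_iff by force
    \<comment> \<open>The schemes need to be controlled for times \<open>r\<close> with \<open>\<bar>r - t\<bar> \<le> d + h < 2 d\<close>. There the state
      moves by at most \<open>3 M d\<close> and is off by another \<open>d\<close>, which adds up to \<open>(3 M + 3) d < \<delta>\<close>.\<close>
    define d where "d = \<delta> / (3 * M + 4)"
    have d: "d > 0" "(3 * M + 4) * d = \<delta>"
      using M \<open>\<delta> > 0\<close> by (auto simp: d_def)
    have "\<forall>\<^sub>F k in sequentially. h k < d \<and> dist (?E k t) (x t) < d"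
      using order_tendstoD(2)[OF h(2) d(1)] tendstoD[OF lim[OF \<open>a \<le> t\<close>] d(1)]
      by eventually_elim auto
    then have close: "\<forall>\<^sub>F k in sequentially. \<forall>r. a \<le> r \<longrightarrow> \<bar>r - t\<bar> \<le> d + h k \<longrightarrow>
        norm (F (?E k r) r - ?v) \<le> \<epsilon>"
    proof eventually_elim
      case (elim k)
      show ?case
      proof (intro allI impI)
        fix r assume r: "a \<le> r" "\<bar>r - t\<bar> \<le> d + h k"
        have "dist (?E k r) (?E k t) \<le> M * (\<bar>r - t\<bar> + h k)"
          unfolding dist_norm using r \<open>a \<le> t\<close> h bound
          by (intro euler_step_lipschitz_up_to_mesh) auto
        also have "\<dots> \<le> M * (3 * d)"
          using M r elim by (intro mult_left_mono) auto
        finally have "dist (?E k r) (x t) < M * (3 * d) + d"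
          using elim dist_triangle[of "?E k r" "x t" "?E k t"] by simp
        moreover have "dist (?E k r, r) (x t, t) \<le> dist (?E k r) (x t) + \<bar>r - t\<bar>"
          using sqrt_sum_squares_le_sum_abs[of "dist (?E k r) (x t)" "dist r t"]
          by (simp add: dist_Pair_Pair dist_real_def)
        ultimately have "dist (?E k r, r) (x t, t) < (3 * M + 4) * d"
          using r elim d by (simp add: algebra_simps)
        then show "norm (F (?E k r) r - ?v) \<le> \<epsilon>"
          using \<delta>[OF r(1)] d by (simp add: dist_norm less_imp_le)
      qed
    qed
    have incr: "norm (x q - x p - (q - p) *\<^sub>R ?v) \<le> \<epsilon> * (q - p)"
      if "a \<le> p" "p \<le> q" "t - d \<le> p" "q \<le> t + d" for p q
    proof (rule tendsto_le[OF sequentially_bot])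
      have "(\<lambda>k. \<epsilon> * (q - p + h k) + h k * norm ?v) \<longlonglongrightarrow> \<epsilon> * (q - p + 0) + 0 * norm ?v"
        by (intro tendsto_intros h(2))
      then show "(\<lambda>k. \<epsilon> * (q - p + h k) + h k * norm ?v) \<longlonglongrightarrow> \<epsilon> * (q - p)"
        by simp
      show "(\<lambda>k. norm (?E k q - ?E k p - (q - p) *\<^sub>R ?v)) \<longlonglongrightarrow> norm (x q - x p - (q - p) *\<^sub>R ?v)"
        using that by (intro tendsto_intros lim) auto
      show "\<forall>\<^sub>F k in sequentially. norm (?E k q - ?E k p - (q - p) *\<^sub>R ?v)
              \<le> \<epsilon> * (q - p + h k) + h k * norm ?v"
        using close
      proof eventually_elim
        case (elim k)
        show ?case
          using that \<open>\<epsilon> > 0\<close> h(1)[of k] by (intro euler_step_increment elim[rule_format]) auto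
      qed
    qed
    have "norm (x s - x t - (s - t) *\<^sub>R ?v) \<le> \<epsilon> * norm (s - t)"
      if s: "s \<in> {a..}" "norm (s - t) < d" for s
    proof (cases "t \<le> s")
      case True
      then show ?thesis
        using incr[of t s] s \<open>a \<le> t\<close> by auto
    next
      case False
      have "norm (x s - x t - (s - t) *\<^sub>R ?v) = norm (x t - x s - (t - s) *\<^sub>R ?v)"
        by (subst norm_minus_cancel[symmetric]) (simp add: algebra_simps)
      then show ?thesis
        using incr[of s t] s False d by auto
    qed
    then show ?thesis
      using d by blast
  qed
  then show ?thesis
    unfolding has_vector_derivative_def has_derivative_within_alt
    by (simp add: bounded_linear_scaleR_left)
qed

text \<open>
  The uniform bound on \<open>F\<close> excludes blow-up, so the solution exists on the whole half-line.
\<close>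

theorem peano_existence_bounded:
  fixes F :: "'a::{real_normed_vector,heine_borel} \<Rightarrow> real \<Rightarrow> 'a"
  assumes cont: "continuous_on (UNIV \<times> {a..}) (\<lambda>(u, t). F u t)"
    and bound: "\<And>u t. a \<le> t \<Longrightarrow> norm (F u t) \<le> M"
  obtains x where "x a = x0" "M-lipschitz_on {a..} x"
    "\<And>t. a \<le> t \<Longrightarrow> (x has_vector_derivative F (x t) t) (at t within {a..})"
proof -
  obtain h x where h: "\<And>k::nat. h k > 0" "h \<longlonglongrightarrow> 0"
    and lim: "\<And>t. a \<le> t \<Longrightarrow> (\<lambda>k. euler_step F a x0 (h k) t) \<longlonglongrightarrow> x t"
    using euler_steps_subsequence_converges[of a F M x0, OF bound] by metis
  have "x a = x0"
  proof (rule LIMSEQ_unique)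
    show "(\<lambda>k. euler_step F a x0 (h k) a) \<longlonglongrightarrow> x a"
      by (rule lim) simp
    show "(\<lambda>k. euler_step F a x0 (h k) a) \<longlonglongrightarrow> x0"
      by simp
  qed
  moreover have "M-lipschitz_on {a..} x"
  proof (rule lipschitz_onI)
    show "M \<ge> 0"
      using bound[of a x0] norm_ge_zero order_trans by blast
    show "dist (x s) (x t) \<le> M * dist s t" if "s \<in> {a..}" "t \<in> {a..}" for s t
      unfolding dist_norm
    proof (rule LIMSEQ_le)
      show "(\<lambda>k. norm (euler_step F a x0 (h k) s - euler_step F a x0 (h k) t))
              \<longlonglongrightarrow> norm (x s - x t)"
        using that by (intro tendsto_intros lim) auto
      have "(\<lambda>k. M * (\<bar>s - t\<bar> + h k)) \<longlonglongrightarrow> M * (\<bar>s - t\<bar> + 0)"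
        by (intro tendsto_intros h(2))
      then show "(\<lambda>k. M * (\<bar>s - t\<bar> + h k)) \<longlonglongrightarrow> M * norm (s - t)"
        by simp
      show "\<exists>N. \<forall>k\<ge>N. norm (euler_step F a x0 (h k) s - euler_step F a x0 (h k) t)
              \<le> M * (\<bar>s - t\<bar> + h k)"
        using that h bound by (auto intro!: euler_step_lipschitz_up_to_mesh)
    qed
  qed
  moreover have "(x has_vector_derivative F (x t) t) (at t within {a..})" if "a \<le> t" for t
    by (rule euler_limit_has_vector_derivative[where M = M and h = h and ?x0.0 = x0])
      (fact cont bound h lim that)+
  ultimately show thesis
    by (rule that[of x])
qed

section \<open>Continuity of the minimal-norm element\<close>

text \<open>
  The projection \<open>q\<close> of the origin onto a convex set satisfies \<open>\<parallel>q\<parallel>\<^sup>2 \<le> q \<bullet> b\<close> for every point \<open>b\<close> of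
  that set. Applied to a point near the other projection \<open>p\<close>, this bounds \<open>p \<bullet> q\<close> from below by
  \<open>\<parallel>q\<parallel>\<^sup>2 - \<epsilon> \<parallel>q\<parallel>\<close>; by symmetry also by \<open>\<parallel>p\<parallel>\<^sup>2 - \<epsilon> \<parallel>p\<parallel>\<close>. Adding the two bounds gives the claim.
\<close>

lemma norm_diff_closest_points_le:
  fixes A B :: "'a::euclidean_space set"
  assumes A: "convex A" "closed A" "A \<noteq> {}" and B: "convex B" "closed B" "B \<noteq> {}"
    and AB: "\<And>a. a \<in> A \<Longrightarrow> \<exists>b\<in>B. dist a b \<le> \<epsilon>"
    and BA: "\<And>b. b \<in> B \<Longrightarrow> \<exists>a\<in>A. dist a b \<le> \<epsilon>"
  shows "(norm (closest_point A 0 - closest_point B 0))\<^sup>2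
         \<le> \<epsilon> * (norm (closest_point A 0) + norm (closest_point B 0))"
proof -
  have half: "(norm (closest_point T 0))\<^sup>2 - \<epsilon> * norm (closest_point T 0) \<le> closest_point T 0 \<bullet> p"
    if T: "convex T" "closed T" and b: "b \<in> T" "dist p b \<le> \<epsilon>" for T b and p :: 'a
  proof -
    let ?q = "closest_point T 0"
    have "(0 - ?q) \<bullet> (b - ?q) \<le> 0"
      using T b by (intro closest_point_dot)
    then have "(norm ?q)\<^sup>2 \<le> ?q \<bullet> b"
      by (simp add: inner_diff_right power2_norm_eq_inner)
    also have "\<dots> = ?q \<bullet> p + ?q \<bullet> (b - p)"
      by (simp add: inner_diff_right)
    also have "?q \<bullet> (b - p) \<le> norm ?q * \<epsilon>"
      using b norm_cauchy_schwarz[of ?q "b - p"] mult_left_mono[of "norm (b - p)" \<epsilon> "norm ?q"]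
      by (simp add: dist_norm norm_minus_commute)
    finally show ?thesis
      by (simp add: algebra_simps)
  qed
  let ?p = "closest_point A 0" and ?q = "closest_point B 0"
  obtain b where "b \<in> B" "dist ?p b \<le> \<epsilon>"
    using AB closest_point_in_set A by metis
  moreover obtain a where "a \<in> A" "dist ?q a \<le> \<epsilon>"
    using BA closest_point_in_set B by (metis dist_commute)
  ultimately show ?thesis
    using half[of B b ?p] half[of A a ?q] A B
    by (simp add: power2_norm_eq_inner inner_diff inner_commute algebra_simps)
qed

lemma convex_hull_range_within_distance:
  fixes v w :: "'i \<Rightarrow> 'a::real_normed_vector"
  assumes near: "\<And>i. dist (v i) (w i) \<le> \<epsilon>" and "p \<in> convex hull (range v)"
  shows "\<exists>q \<in> convex hull (range w). dist p q \<le> \<epsilon>"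
proof -
  \<comment> \<open>The closed \<open>\<epsilon>\<close>-neighbourhood of the second hull, written as a Minkowski sum because sums of
    convex sets are convex.\<close>
  define T where "T = (\<Union>q\<in>convex hull (range w). \<Union>z\<in>cball 0 \<epsilon>. {q + z})"
  have "v i \<in> T" for i
  proof -
    have "v i = w i + (v i - w i)" "v i - w i \<in> cball 0 \<epsilon>" "w i \<in> convex hull (range w)"
      using near[of i] by (auto simp: dist_norm norm_minus_commute hull_inc)
    then show ?thesis
      unfolding T_def by blast
  qed
  moreover have "convex T"
    unfolding T_def by (intro convex_sums convex_convex_hull convex_cball)
  ultimately have "convex hull (range v) \<subseteq> T"
    by (intro hull_minimal) auto
  then obtain q z where "q \<in> convex hull (range w)" "z \<in> cball 0 \<epsilon>" "p = q + z"
    using assms(2) unfolding T_def by blast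
  then show ?thesis
    by (intro bexI[of _ q]) (auto simp: dist_norm)
qed

lemma norm_closest_point_convex_hull_le:
  fixes v :: "'i::finite \<Rightarrow> 'a::euclidean_space"
  assumes "\<And>i. norm (v i) \<le> K"
  shows "norm (closest_point (convex hull (range v)) 0) \<le> K"
proof -
  have "closest_point (convex hull (range v)) 0 \<in> convex hull (range v)"
    by (intro closest_point_in_set compact_imp_closed compact_convex_hull) (auto simp: finite_imp_compact)
  also have "\<dots> \<subseteq> cball 0 K"
    using assms by (intro hull_minimal) auto
  finally show ?thesis by simp
qed

lemma continuous_on_closest_point_convex_hull:
  fixes v :: "'i::finite \<Rightarrow> 'b::metric_space \<Rightarrow> 'a::euclidean_space"
  assumes cont: "\<And>i. continuous_on S (v i)"
    and bound: "\<And>i z. z \<in> S \<Longrightarrow> norm (v i z) \<le> K"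
  shows "continuous_on S (\<lambda>z. closest_point (convex hull (range (\<lambda>i. v i z))) 0)"
  unfolding continuous_on_iff
proof (intro ballI allI impI)
  fix z e assume "z \<in> S" and "(e::real) > 0"
  let ?H = "\<lambda>z. convex hull (range (\<lambda>i. v i z))"
  let ?p = "\<lambda>z. closest_point (?H z) 0"
  have "K \<ge> 0"
    using bound[OF \<open>z \<in> S\<close>] norm_ge_zero order_trans by blast
  \<comment> \<open>By \<open>norm_diff_closest_points_le\<close> the squared distance of the projections is at most \<open>2 K \<eta>\<close>; the
    extra \<open>1\<close> makes the bound strict and covers \<open>K = 0\<close>.\<close>
  define \<eta> where "\<eta> = e\<^sup>2 / (2 * K + 1)"
  have "\<eta> > 0"
    using \<open>e > 0\<close> \<open>K \<ge> 0\<close> by (simp add: \<eta>_def)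
  have "\<forall>\<^sub>F y in at z within S. \<forall>i. dist (v i y) (v i z) < \<eta>"
    using cont \<open>z \<in> S\<close> \<open>\<eta> > 0\<close>
    by (intro eventually_all_finite tendstoD) (auto simp: continuous_on_def)
  then obtain d where "d > 0"
    and d: "\<And>y. y \<in> S \<Longrightarrow> y \<noteq> z \<Longrightarrow> dist y z < d \<Longrightarrow> \<forall>i. dist (v i y) (v i z) < \<eta>"
    unfolding eventually_at by blast
  have "dist (?p y) (?p z) < e" if "y \<in> S" "dist y z < d" for y
  proof -
    have near: "dist (v i y) (v i z) \<le> \<eta>" for i
      using d[of y] that \<open>\<eta> > 0\<close> by (cases "y = z") (auto simp: less_imp_le)
    have closed: "closed (?H r)" for r
      by (intro compact_imp_closed compact_convex_hull) (auto simp: finite_imp_compact)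
    have "(norm (?p y - ?p z))\<^sup>2 \<le> \<eta> * (norm (?p y) + norm (?p z))"
    proof (rule norm_diff_closest_points_le)
      show "\<exists>b\<in>?H z. dist a b \<le> \<eta>" if "a \<in> ?H y" for a
        by (rule convex_hull_range_within_distance[OF near that])
      show "\<exists>a\<in>?H y. dist a b \<le> \<eta>" if "b \<in> ?H z" for b
        using convex_hull_range_within_distance[OF _ that, of "\<lambda>i. v i y" \<eta>] near
        by (simp add: dist_commute)
    qed (auto simp: closed)
    also have "\<dots> \<le> \<eta> * (K + K)"
      using \<open>\<eta> > 0\<close> bound \<open>z \<in> S\<close> \<open>y \<in> S\<close>
      by (intro mult_left_mono add_mono norm_closest_point_convex_hull_le) auto
    also have "\<dots> < \<eta> * (2 * K + 1)"
      using \<open>\<eta> > 0\<close> by simp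
    also have "\<dots> = e\<^sup>2"
      using \<open>K \<ge> 0\<close> by (simp add: \<eta>_def)
    finally show ?thesis
      using \<open>e > 0\<close> by (simp add: dist_norm power2_less_imp_less)
  qed
  then show "\<exists>d>0. \<forall>y\<in>S. dist y z < d \<longrightarrow> dist (?p y) (?p z) < e"
    using \<open>d > 0\<close> by blast
qed

section \<open>Global solutions of the flow\<close>

lemma lipschitz_on_imp_absolutely_continuous_on:
  assumes "C-lipschitz_on S x"
  shows "absolutely_continuous_on S x"
  unfolding absolutely_continuous_on_def
proof (intro allI impI)
  fix \<epsilon> :: real assume "\<epsilon> > 0"
  have "C \<ge> 0"
    using assms by (rule lipschitz_on_nonneg)
  show "\<exists>\<delta>>0. \<forall>D. finite D \<and> (\<forall>(a, b)\<in>D. a < b \<and> {a..b} \<subseteq> S) \<and>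
      pairwise (\<lambda>(a, b) (c, d). disjnt {a<..<b} {c<..<d}) D \<and> (\<Sum>(a, b)\<in>D. b - a) < \<delta> \<longrightarrow>
      (\<Sum>(a, b)\<in>D. norm (x b - x a)) < \<epsilon>"
  proof (intro exI[of _ "\<epsilon> / (C + 1)"] conjI allI impI; (elim conjE)?)
    show "\<epsilon> / (C + 1) > 0"
      using \<open>\<epsilon> > 0\<close> \<open>C \<ge> 0\<close> by simp
    fix D :: "(real \<times> real) set"
    assume D: "\<forall>(a, b)\<in>D. a < b \<and> {a..b} \<subseteq> S" "(\<Sum>(a, b)\<in>D. b - a) < \<epsilon> / (C + 1)"
    have "norm (x b - x a) \<le> C * (b - a)" if "(a, b) \<in> D" for a b
    proof -
      have "a < b" "a \<in> S" "b \<in> S"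
        using D(1) that by force+
      then show ?thesis
        using lipschitz_on_normD[OF assms, of b a] by simp
    qed
    then have "(\<Sum>(a, b)\<in>D. norm (x b - x a)) \<le> (\<Sum>(a, b)\<in>D. C * (b - a))"
      by (intro sum_mono) auto
    also have "\<dots> = C * (\<Sum>(a, b)\<in>D. b - a)"
      by (simp add: sum_distrib_left case_prod_unfold)
    also have "\<dots> \<le> C * (\<epsilon> / (C + 1))"
      using D(2) \<open>C \<ge> 0\<close> by (intro mult_left_mono) auto
    also have "\<dots> < \<epsilon>"
      using \<open>\<epsilon> > 0\<close> \<open>C \<ge> 0\<close> by (simp add: field_simps)
    finally show "(\<Sum>(a, b)\<in>D. norm (x b - x a)) < \<epsilon>" .
  qed
qed

text \<open>
  The constant may be negative here, which \<^const>\<open>lipschitz_on\<close> excludes; replacing it by its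
  absolute value reduces one notion to the other.
\<close>

lemma lipschitz_bound_imp_continuous_on:
  fixes g :: "'a::real_normed_vector \<Rightarrow> 'b::real_normed_vector"
  assumes "\<And>x y. x \<in> S \<Longrightarrow> y \<in> S \<Longrightarrow> norm (g x - g y) \<le> C * norm (x - y)"
  shows "continuous_on S g"
proof (rule lipschitz_on_continuous_on[OF lipschitz_onI])
  fix x y assume "x \<in> S" "y \<in> S"
  then have "norm (g x - g y) \<le> C * norm (x - y)"
    by (rule assms)
  also have "\<dots> \<le> \<bar>C\<bar> * norm (x - y)"
    by (intro mult_right_mono) auto
  finally show "dist (g x) (g y) \<le> \<bar>C\<bar> * dist x y"
    by (simp add: dist_norm)
qed auto

theorem theorem3p3:
  fixes f :: "'m::finite \<Rightarrow> real ^ 'n::finite \<Rightarrow> real"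
    and \<alpha> :: "'m \<Rightarrow> real ^ 'n \<Rightarrow> real \<Rightarrow> real"
    and L\<^sub>\<alpha> :: "'m \<Rightarrow> real"
    and t\<^sub>0 \<alpha>\<^sub>m\<^sub>i\<^sub>n \<alpha>\<^sub>m\<^sub>a\<^sub>x L :: real
  assumes "t\<^sub>0 \<ge> 0"
    and "0 < \<alpha>\<^sub>m\<^sub>i\<^sub>n" and "\<alpha>\<^sub>m\<^sub>i\<^sub>n \<le> \<alpha>\<^sub>m\<^sub>a\<^sub>x"
    and \<alpha>_lipschitz: "\<And>i u v t s. t \<ge> t\<^sub>0 \<Longrightarrow> s \<ge> t\<^sub>0 \<Longrightarrow>
           \<bar>\<alpha> i u t - \<alpha> i v s\<bar> \<le> L\<^sub>\<alpha> i * norm ((u, t) - (v, s))"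
    and \<alpha>_bounds: "\<And>i u t. t \<ge> t\<^sub>0 \<Longrightarrow> \<alpha>\<^sub>m\<^sub>i\<^sub>n \<le> \<alpha> i u t \<and> \<alpha> i u t \<le> \<alpha>\<^sub>m\<^sub>a\<^sub>x"
    and A1_differentiable: "\<And>i x. f i differentiable (at x)"
    and A1_bounded_below: "\<And>i. bdd_below (range (f i))"
    and A1_lipschitz: "\<And>i x y. norm (gradient (f i) x - gradient (f i) y) \<le> L * norm (x - y)"
    and A2: "\<exists>M>0. \<forall>i x. norm (gradient (f i) x) \<le> M"
    and A3: "\<And>a :: real ^ 'm. bounded {x. \<forall>i. f i x \<le> a $ i}"
  shows "\<forall>x\<^sub>0. \<exists>x :: real \<Rightarrow> real ^ 'n.
           locally_absolutely_continuous_on {t\<^sub>0..} x \<and>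
           (AE t in lebesgue_on {t\<^sub>0..}.
              (x has_vector_derivative - closest_point (C_alpha f \<alpha> (x t) t) 0)
                (at t within {t\<^sub>0..})) \<and>
           x t\<^sub>0 = x\<^sub>0"
proof
  fix x\<^sub>0 :: "real ^ 'n"
  obtain M where M: "M > 0" "\<And>i x. norm (gradient (f i) x) \<le> M"
    using A2 by blast
  define v where "v i = (\<lambda>(u, t). gradient (f i) u /\<^sub>R \<alpha> i u t)" for i
  define F where "F u t = - closest_point (C_alpha f \<alpha> u t) 0" for u t
  have v_cont: "continuous_on (UNIV \<times> {t\<^sub>0..}) (v i)" for i
  proof -
    have "continuous_on UNIV (gradient (f i))"
      using A1_lipschitz by (rule lipschitz_bound_imp_continuous_on)
    then have "continuous_on (UNIV \<times> {t\<^sub>0..}) (\<lambda>z. gradient (f i) (fst z))"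
      by (rule continuous_on_compose2) (auto intro!: continuous_intros)
    moreover have "continuous_on (UNIV \<times> {t\<^sub>0..}) (\<lambda>z. \<alpha> i (fst z) (snd z))"
      using \<alpha>_lipschitz by (intro lipschitz_bound_imp_continuous_on[where C = "L\<^sub>\<alpha> i"]) auto
    moreover have "\<alpha> i u t \<noteq> 0" if "t \<ge> t\<^sub>0" for u t
      using \<alpha>_bounds[OF that, of i u] \<open>0 < \<alpha>\<^sub>m\<^sub>i\<^sub>n\<close> by linarith
    then have "\<forall>z \<in> UNIV \<times> {t\<^sub>0..}. \<alpha> i (fst z) (snd z) \<noteq> 0"
      by auto
    ultimately show ?thesis
      unfolding v_def case_prod_unfold by (intro continuous_intros)
  qed
  have v_bound: "norm (v i z) \<le> M / \<alpha>\<^sub>m\<^sub>i\<^sub>n" if z_in: "z \<in> UNIV \<times> {t\<^sub>0..}" for i z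
  proof -
    obtain u t where z: "z = (u, t)" "t \<ge> t\<^sub>0"
      using z_in by auto
    have "norm (gradient (f i) u) / \<alpha> i u t \<le> M / \<alpha>\<^sub>m\<^sub>i\<^sub>n"
      using \<alpha>_bounds[OF z(2), of i u] M \<open>0 < \<alpha>\<^sub>m\<^sub>i\<^sub>n\<close> by (intro frac_le) auto
    then show ?thesis
      using \<alpha>_bounds[OF z(2), of i u] \<open>0 < \<alpha>\<^sub>m\<^sub>i\<^sub>n\<close> by (simp add: z v_def divide_inverse mult.commute)
  qed
  have F_eq: "F u t = - closest_point (convex hull (range (\<lambda>i. v i (u, t)))) 0" for u t
    by (simp add: F_def C_alpha_def v_def)
  have "continuous_on (UNIV \<times> {t\<^sub>0..}) (\<lambda>(u, t). F u t)"
    using continuous_on_minus[OF continuous_on_closest_point_convex_hull[OF v_cont v_bound]]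
    by (simp add: F_eq case_prod_unfold)
  moreover have "norm (F u t) \<le> M / \<alpha>\<^sub>m\<^sub>i\<^sub>n" if "t\<^sub>0 \<le> t" for u t
    unfolding F_eq norm_minus_cancel using v_bound that
    by (intro norm_closest_point_convex_hull_le) auto
  ultimately obtain x where x: "x t\<^sub>0 = x\<^sub>0" "(M / \<alpha>\<^sub>m\<^sub>i\<^sub>n)-lipschitz_on {t\<^sub>0..} x"
    "\<And>t. t\<^sub>0 \<le> t \<Longrightarrow> (x has_vector_derivative F (x t) t) (at t within {t\<^sub>0..})"
    using peano_existence_bounded[of t\<^sub>0 F "M / \<alpha>\<^sub>m\<^sub>i\<^sub>n" x\<^sub>0] by blast
  have "locally_absolutely_continuous_on {t\<^sub>0..} x"
    unfolding locally_absolutely_continuous_on_def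
    using lipschitz_on_imp_absolutely_continuous_on lipschitz_on_subset[OF x(2)] by blast
  moreover have "AE t in lebesgue_on {t\<^sub>0..}.
      (x has_vector_derivative - closest_point (C_alpha f \<alpha> (x t) t) 0) (at t within {t\<^sub>0..})"
    using x(3) by (intro AE_I2) (simp add: F_def space_restrict_space)
  ultimately show "\<exists>x. locally_absolutely_continuous_on {t\<^sub>0..} x \<and>
      (AE t in lebesgue_on {t\<^sub>0..}.
         (x has_vector_derivative - closest_point (C_alpha f \<alpha> (x t) t) 0) (at t within {t\<^sub>0..})) \<and>
      x t\<^sub>0 = x\<^sub>0"
    using x(1) by blast
qed

end
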